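(* Let $n\ge 1$ be an integer, let $(A,B,W)$ be a partition of $\{0,1\}^n$ and assume $|A|=\frac12$. Then \[ |\nabla(A,B)|+n^{0.50057}\,|W|\ \ge\ \tfrac12 . \]
   Context: The Hamming cube $\{0,1\}^n$ is viewed as a graph in which two vertices are joined by an edge iff they differ in exactly one coordinate; $\mathcal{E}$ is its set of edges. For a set $S\subset\{0,1\}^n$, $|S|=2^{-n}\#S$ is its normalized measure. Moreover $|\nabla(A,B)|=2^{-n}\,\#\{(x,y)\in\mathcal{E}: x\in A,\ y\in B\}$, i.e. $2^{-n}$ times the number of edges joining a vertex of $A$ to a vertex of $B$. A partition $(A,B,W)$ means that $A,B,W$ are pairwise disjoint with union $\{0,1\}^n$. *)

theory Defs
  imports "HOL-Analysis.Analysis"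
begin

definition cube :: "nat \<Rightarrow> bool list set" where
  "cube n = {x. length x = n}"

text \<open>Each edge appears in both orientations. For disjoint \<open>A\<close> and \<open>B\<close>, an edge joining them
  has exactly one orientation from \<open>A\<close> to \<open>B\<close>, so \<open>edge_measure\<close> below counts it once.\<close>

definition cube_edges :: "nat \<Rightarrow> (bool list \<times> bool list) set" where
  "cube_edges n = {(x, y). x \<in> cube n \<and> y \<in> cube n \<and> (\<exists>!i. i < n \<and> x ! i \<noteq> y ! i)}"

definition cube_measure :: "nat \<Rightarrow> bool list set \<Rightarrow> real" where
  "cube_measure n S = real (card S) / 2 ^ n"

definition edge_measure :: "nat \<Rightarrow> bool list set \<Rightarrow> bool list set \<Rightarrow> real" where
  "edge_measure n A B = real (card {(x, y) \<in> cube_edges n. x \<in> A \<and> y \<in> B}) / 2 ^ n"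

text \<open>The parts are allowed to be empty.\<close>

definition cube_partition :: "nat \<Rightarrow> bool list set \<Rightarrow> bool list set \<Rightarrow> bool list set \<Rightarrow> bool" where
  "cube_partition n A B W \<longleftrightarrow>
     A \<inter> B = {} \<and> A \<inter> W = {} \<and> B \<inter> W = {} \<and> A \<union> B \<union> W = cube n"

end

theory Submission
  imports Defs
begin

text \<open>
  Let \<open>C = B \<union> W\<close> be the complement of \<open>A\<close> and, for \<open>x \<in> C\<close>, let \<open>h x\<close> be the number of neighbours
  of \<open>x\<close> outside \<open>C\<close>.  A vertex \<open>x\<close> of \<open>B\<close> contributes \<open>h x \<ge> sqrt (h x)\<close> edges to the edge boundary
  between \<open>A\<close> and \<open>B\<close>, and a vertex of \<open>W\<close> is weighted by \<open>n powr 0.50057 \<ge> sqrt n \<ge> sqrt (h x)\<close>.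
  So it suffices that the average of \<open>sqrt (h x)\<close> over the cube, with \<open>x\<close> restricted to \<open>C\<close>, is at
  least \<open>1/2\<close> whenever \<open>C\<close> has measure \<open>1/2\<close>.

  The average is bounded below by \<open>profile |C|\<close> for an explicit polynomial \<open>profile\<close> of degree six with
  \<open>profile 0 = profile 1 = 0\<close> and \<open>profile (1/2) = 1/2\<close>.  The proof is by induction on the dimension
  (\<open>profile_le_boundary\<close>).  Cutting the cube along one coordinate splits \<open>C\<close> into two sections of
  measures \<open>x \<ge> y\<close>.  At the points of the larger section that are missing from the smaller one, whose
  measure is at least \<open>x - y\<close>, \<open>h\<close> grows by one.  If \<open>\<alpha>, \<beta>\<close> are such that
  \<open>sqrt (h + 1) \<ge> \<alpha> * sqrt h + \<beta>\<close> for all natural numbers \<open>h\<close>, then the induction closes as soon as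
  \<open>\<alpha> * profile x + \<beta> * (x - y) + profile y \<ge> 2 * profile ((x + y) / 2)\<close>.  Hence everything rests on
  finding, for each pair \<open>x \<ge> y\<close>, an admissible \<open>(\<alpha>, \<beta>)\<close> with this property (\<open>two_point\<close>).

  Two kinds of pairs are used.  Points of the unit circle are admissible by Cauchy-Schwarz; the best of
  them turns \<open>\<alpha> * profile x + \<beta> * (x - y)\<close> into \<open>sqrt ((profile x)\<^sup>2 + (x - y)\<^sup>2)\<close>.  The pair \<open>(12/29, 1)\<close>
  is admissible because \<open>h\<close> is an integer and \<open>12/29 < sqrt 2 - 1\<close>.  It is needed near \<open>x = 1, y = 0\<close>,
  where the inequality is an equality (a half cube).  In the coordinates \<open>x\<close> and \<open>y/x\<close> the remaining
  statement says that one of a few polynomials is nonnegative at each point of the unit square; it is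
  certified by subdividing the square and bounding each polynomial on each piece by its Taylor
  coefficients at the centre.

  The polynomial was found numerically.  Near the diagonal \<open>x = y\<close> the two-point inequality amounts to
  \<open>profile x * profile'' x > -2\<close>, the differential inequality behind the Gaussian isoperimetric
  profile; the coefficients were chosen to satisfy it together with the constraints away from the
  diagonal, with some room to spare everywhere except at the half cube.
\<close>


section \<open>The profile and admissible slopes\<close>

definition profile :: "real \<Rightarrow> real" where
  "profile x = (51 * x - 99 * x ^ 2 + 228 * x ^ 3 - 420 * x ^ 4 + 368 * x ^ 5 - 128 * x ^ 6) / 25"

lemma profile_simps [simp]: "profile 0 = 0" "profile 1 = 0" "profile (1 / 2) = 1 / 2"
  by (simp_all add: profile_def power_divide)

lemma profile_nonneg:
  assumes "0 \<le> x" "x \<le> 1"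
  shows "0 \<le> profile x"
proof -
  define u where "u = 2 * x - 1"
  have u: "\<bar>u\<bar> \<le> 1" using assms by (auto simp: u_def)
  have "\<bar>u ^ 3\<bar> \<le> 1" using u by (simp add: power_abs power_le_one)
  moreover have "0 \<le> u ^ 2" "0 \<le> u ^ 4" by simp_all
  ultimately have "0 \<le> 50 + 8 * u + 3 * u ^ 2 + 2 * u ^ 3 + 8 * u ^ 4"
    using u by linarith
  then have "0 \<le> x * (1 - x) * (50 + 8 * u + 3 * u ^ 2 + 2 * u ^ 3 + 8 * u ^ 4) / 25"
    using assms by simp
  also have "\<dots> = profile x"
    unfolding u_def profile_def by (simp add: algebra_simps eval_nat_numeral)
  finally show ?thesis .
qed

definition admissible :: "real \<Rightarrow> real \<Rightarrow> bool" where
  "admissible \<alpha> \<beta> \<longleftrightarrow> 0 \<le> \<alpha> \<and> \<alpha> \<le> 1 \<and> 0 \<le> \<beta> \<and>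
     (\<forall>h::nat. \<alpha> * sqrt (real h) + \<beta> \<le> sqrt (real h + 1))"

lemma admissible_circle:
  assumes "0 \<le> \<alpha>" "0 \<le> \<beta>" "\<alpha> ^ 2 + \<beta> ^ 2 = 1"
  shows "admissible \<alpha> \<beta>"
proof -
  have "\<alpha> * sqrt (real h) + \<beta> \<le> sqrt (real h + 1)" for h :: nat
  proof (rule real_le_rsqrt)
    define r where "r = sqrt (real h)"
    have r: "r ^ 2 = real h" by (simp add: r_def)
    have "(\<alpha> * r + \<beta>) ^ 2 + (\<alpha> - \<beta> * r) ^ 2 = (\<alpha> ^ 2 + \<beta> ^ 2) * (r ^ 2 + 1)"
      by (simp add: algebra_simps power2_eq_square)
    then have "(\<alpha> * r + \<beta>) ^ 2 + (\<alpha> - \<beta> * r) ^ 2 = real h + 1"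
      unfolding assms(3) r by simp
    then show "(\<alpha> * sqrt (real h) + \<beta>) ^ 2 \<le> real h + 1"
      unfolding r_def[symmetric] using zero_le_power2[of "\<alpha> - \<beta> * r"] by linarith
  qed
  moreover have "\<alpha> ^ 2 \<le> 1" using assms(3) zero_le_power2[of \<beta>] by linarith
  then have "\<alpha> \<le> 1" by (intro power2_le_imp_le[of \<alpha> 1]) auto
  ultimately show ?thesis using assms by (auto simp: admissible_def)
qed

text \<open>Since \<open>sqrt (h + 1)\<close> is a convex function of \<open>sqrt h\<close>, the line of slope \<open>sqrt 2 - 1\<close> that agrees
  with it at \<open>h = 0\<close> and \<open>h = 1\<close> lies below it at all integers, though not between \<open>0\<close> and \<open>1\<close>.  The
  fraction \<open>12/29\<close> is a convergent of \<open>sqrt 2 - 1\<close> from below.\<close>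

lemma admissible_step: "admissible (12 / 29) 1"
proof -
  have "12 / 29 * sqrt (real h) + 1 \<le> sqrt (real h + 1)" for h :: nat
  proof (rule real_le_rsqrt)
    define r where "r = sqrt (real h)"
    have r: "r ^ 2 = real h" by (simp add: r_def)
    have "r \<le> r ^ 2"
    proof (cases "h = 0")
      case False
      then have "1 \<le> r" by (simp add: r_def)
      then show ?thesis by (simp add: power2_eq_square)
    qed (simp add: r_def)
    then have "696 * r \<le> 697 * r ^ 2" using zero_le_power2[of r] by linarith
    then show "(12 / 29 * sqrt (real h) + 1) ^ 2 \<le> real h + 1"
      unfolding r_def[symmetric] using r by (simp add: power2_eq_square algebra_simps)
  qed
  then show ?thesis by (simp add: admissible_def)
qed


section \<open>Positivity certificates for bivariate polynomials\<close>

text \<open>Polynomials are dense coefficient lists with integer entries, the constant term first; a bivariate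
  polynomial is a list, indexed by the power of \<open>s\<close>, of polynomials in \<open>t\<close>.\<close>

primrec eval1 :: "int list \<Rightarrow> real \<Rightarrow> real" where
  "eval1 [] t = 0"
| "eval1 (c # p) t = of_int c + t * eval1 p t"

primrec eval2 :: "int list list \<Rightarrow> real \<Rightarrow> real \<Rightarrow> real" where
  "eval2 [] s t = 0"
| "eval2 (p # P) s t = eval1 p t + s * eval2 P s t"

fun add1 :: "int list \<Rightarrow> int list \<Rightarrow> int list" where
  "add1 [] q = q"
| "add1 p [] = p"
| "add1 (a # p) (b # q) = (a + b) # add1 p q"

fun add2 :: "int list list \<Rightarrow> int list list \<Rightarrow> int list list" where
  "add2 [] Q = Q"
| "add2 P [] = P"
| "add2 (p # P) (q # Q) = add1 p q # add2 P Q"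

definition smult1 :: "int \<Rightarrow> int list \<Rightarrow> int list" where
  "smult1 a p = map ((*) a) p"

definition smult2 :: "int \<Rightarrow> int list list \<Rightarrow> int list list" where
  "smult2 a P = map (smult1 a) P"

lemma eval1_add1 [simp]: "eval1 (add1 p q) t = eval1 p t + eval1 q t"
  by (induction p q rule: add1.induct) (auto simp: algebra_simps)

lemma eval1_smult1 [simp]: "eval1 (smult1 a p) t = a * eval1 p t"
  by (induction p) (auto simp: algebra_simps smult1_def)

lemma eval2_add2 [simp]: "eval2 (add2 P Q) s t = eval2 P s t + eval2 Q s t"
  by (induction P Q rule: add2.induct) (auto simp: algebra_simps)

lemma eval2_smult2 [simp]: "eval2 (smult2 a P) s t = a * eval2 P s t"
  by (induction P) (auto simp: algebra_simps smult2_def)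

(* The shifted tail is bound by an abstraction so that rewriting evaluates it only once. *)
primrec shift1 :: "int \<Rightarrow> int list \<Rightarrow> int list" where
  "shift1 e [] = []"
| "shift1 e (c # p) = (\<lambda>q. add1 (c # q) (smult1 e q)) (shift1 e p)"

primrec shift2 :: "int \<Rightarrow> int list list \<Rightarrow> int list list" where
  "shift2 e [] = []"
| "shift2 e (p # P) = (\<lambda>Q. add2 (p # Q) (smult2 e Q)) (shift2 e P)"

lemma eval1_shift1 [simp]: "eval1 (shift1 e p) t = eval1 p (t + e)"
  by (induction p) (auto simp: algebra_simps)

lemma eval2_shift2 [simp]: "eval2 (shift2 e P) s t = eval2 P (s + e) t"
  by (induction P) (auto simp: algebra_simps)

lemma eval2_map_shift1 [simp]: "eval2 (map (shift1 e) P) s t = eval2 P s (t + e)"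
  by (induction P) auto

text \<open>Homogenisation: substituting \<open>t / N\<close> and clearing denominators makes room for repeated bisection
  with integer midpoints.\<close>

primrec scale1 :: "int \<Rightarrow> nat \<Rightarrow> int list \<Rightarrow> int list" where
  "scale1 N n [] = []"
| "scale1 N n (c # p) = N ^ n * c # scale1 N (n - 1) p"

primrec scale2 :: "int \<Rightarrow> nat \<Rightarrow> int \<Rightarrow> nat \<Rightarrow> int list list \<Rightarrow> int list list" where
  "scale2 N n M m [] = []"
| "scale2 N n M m (p # P) = smult1 (N ^ n) (scale1 M m p) # scale2 N (n - 1) M m P"

lemma eval1_scale1: "length p \<le> Suc n \<Longrightarrow> eval1 (scale1 N n p) (of_int N * t) = of_int N ^ n * eval1 p t"
proof (induction p arbitrary: n)
  case (Cons c p)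
  show ?case
  proof (cases n)
    case 0
    then show ?thesis using Cons.prems by auto
  next
    case (Suc m)
    then show ?thesis using Cons by (auto simp: algebra_simps)
  qed
qed auto

lemma eval2_scale2:
  assumes "length P \<le> Suc n" "\<forall>p\<in>set P. length p \<le> Suc m"
  shows "eval2 (scale2 N n M m P) (of_int N * s) (of_int M * t) =
    of_int N ^ n * of_int M ^ m * eval2 P s t"
  using assms
proof (induction P arbitrary: n)
  case (Cons p P)
  have *: "eval1 (scale1 M m p) (of_int M * t) = of_int M ^ m * eval1 p t"
    using Cons.prems by (intro eval1_scale1) auto
  show ?case
  proof (cases n)
    case 0
    then show ?thesis using Cons.prems * by auto
  next
    case (Suc k)
    then show ?thesis using Cons * by (auto simp: algebra_simps)
  qed
qed auto

text \<open>On a box centred at the origin with half-widths \<open>h\<close> and \<open>k\<close>, a polynomial is nonnegative if its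
  constant term dominates all its other terms.\<close>

primrec norm1 :: "int \<Rightarrow> int list \<Rightarrow> int" where
  "norm1 k [] = 0"
| "norm1 k (c # p) = \<bar>c\<bar> + k * norm1 k p"

primrec norm2 :: "int \<Rightarrow> int \<Rightarrow> int list list \<Rightarrow> int" where
  "norm2 h k [] = 0"
| "norm2 h k (p # P) = norm1 k p + h * norm2 h k P"

fun nonneg :: "int \<Rightarrow> int \<Rightarrow> int list list \<Rightarrow> bool" where
  "nonneg h k ((c # p) # P) \<longleftrightarrow> k * norm1 k p + h * norm2 h k P \<le> c"
| "nonneg h k _ \<longleftrightarrow> False"

lemma abs_eval1_le: "\<bar>t\<bar> \<le> of_int k \<Longrightarrow> \<bar>eval1 p t\<bar> \<le> of_int (norm1 k p)"
proof (induction p)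
  case (Cons c p)
  have "\<bar>t * eval1 p t\<bar> \<le> of_int k * of_int (norm1 k p)"
    unfolding abs_mult using Cons by (intro mult_mono) auto
  then show ?case by auto
qed auto

lemma abs_eval2_le:
  assumes "\<bar>s\<bar> \<le> of_int h" "\<bar>t\<bar> \<le> of_int k"
  shows "\<bar>eval2 P s t\<bar> \<le> of_int (norm2 h k P)"
proof (induction P)
  case (Cons p P)
  have "\<bar>s * eval2 P s t\<bar> \<le> of_int h * of_int (norm2 h k P)"
    unfolding abs_mult using Cons assms by (intro mult_mono) auto
  then show ?case using abs_eval1_le[OF assms(2), of p] by auto
qed auto

lemma eval2_nonneg:
  assumes "nonneg h k P" "\<bar>s\<bar> \<le> of_int h" "\<bar>t\<bar> \<le> of_int k"
  shows "0 \<le> eval2 P s t"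
proof -
  obtain c p P' where P: "P = (c # p) # P'" and le: "k * norm1 k p + h * norm2 h k P' \<le> c"
    using assms(1) by (auto elim: nonneg.elims)
  have "\<bar>t * eval1 p t\<bar> \<le> of_int k * of_int (norm1 k p)"
    unfolding abs_mult using assms abs_eval1_le[of t k p] by (intro mult_mono) auto
  moreover have "\<bar>s * eval2 P' s t\<bar> \<le> of_int h * of_int (norm2 h k P')"
    unfolding abs_mult using assms abs_eval2_le[of s h t k P'] by (intro mult_mono) auto
  moreover have "real_of_int (k * norm1 k p + h * norm2 h k P') \<le> of_int c"
    using le by (simp only: of_int_le_iff)
  ultimately show ?thesis using P by auto
qed

text \<open>A certificate bisects a box repeatedly and names, for each final piece, a test.  A test is a list of
  integer weight vectors; it is passed if the corresponding combinations of a fixed family of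
  polynomials are all nonnegative on the piece.  The family and the weights are explained below, where
  they are applied.\<close>

datatype test = Angle int | Step | Corner

datatype cert = SplitX cert cert | SplitT cert cert | Leaf test

fun weights :: "test \<Rightarrow> int list list" where
  "weights (Angle k) = [[2000 * k, 0, - 4 * k * k, - 400, - k * k]]"
| "weights Step = [[0, 1450, - 34, 0, - 29]]"
| "weights Corner = [[0, 0, 0, 0, 0, 1], [0, 0, 0, 0, 0, 0, 1]]"

fun combine :: "int list \<Rightarrow> int list list list \<Rightarrow> int list list" where
  "combine (w # ws) (P # Ps) =
     (if w = 0 then combine ws Ps else add2 (smult2 w P) (combine ws Ps))"
| "combine _ _ = []"

fun dot :: "int list \<Rightarrow> real list \<Rightarrow> real" where
  "dot (w # ws) (x # xs) = of_int w * x + dot ws xs"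
| "dot _ _ = 0"

lemma eval2_combine: "eval2 (combine w Ps) s t = dot w (map (\<lambda>P. eval2 P s t) Ps)"
  by (induction w Ps rule: combine.induct) auto

lemma dot_scale: "dot w (map (\<lambda>P. a * f P) Ps) = a * dot w (map f Ps)"
proof (induction w arbitrary: Ps)
  case (Cons v w)
  then show ?case by (cases Ps) (auto simp: algebra_simps)
qed auto

text \<open>The polynomials are re-centred at each bisection, so that every piece is again centred at the
  origin.\<close>

primrec check :: "cert \<Rightarrow> int \<Rightarrow> int \<Rightarrow> int list list list \<Rightarrow> bool" where
  "check (SplitX c c') h k Ps \<longleftrightarrow> h = 2 * (h div 2) \<and>
     check c (h div 2) k (map (shift2 (- (h div 2))) Ps) \<and>
     check c' (h div 2) k (map (shift2 (h div 2)) Ps)"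
| "check (SplitT c c') h k Ps \<longleftrightarrow> k = 2 * (k div 2) \<and>
     check c h (k div 2) (map (map (shift1 (- (k div 2)))) Ps) \<and>
     check c' h (k div 2) (map (map (shift1 (k div 2))) Ps)"
| "check (Leaf l) h k Ps \<longleftrightarrow> list_all (\<lambda>w. nonneg h k (combine w Ps)) (weights l)"

lemma check_sound:
  assumes "check c h k Ps" "\<bar>s\<bar> \<le> of_int h" "\<bar>t\<bar> \<le> of_int k"
  shows "\<exists>l. \<forall>w\<in>set (weights l). 0 \<le> dot w (map (\<lambda>P. eval2 P s t) Ps)"
  using assms
proof (induction c arbitrary: h k Ps s t)
  case (SplitX c c')
  define g where "g = h div 2"
  have h: "h = 2 * g" using SplitX.prems by (simp add: g_def)
  show ?case
  proof (cases "s \<le> 0")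
    case True
    then show ?thesis
      using SplitX.IH(1)[of g k "map (shift2 (- g)) Ps" "s + g" t] SplitX.prems h
      by (auto simp: g_def[symmetric] comp_def)
  next
    case False
    then show ?thesis
      using SplitX.IH(2)[of g k "map (shift2 g) Ps" "s - g" t] SplitX.prems h
      by (auto simp: g_def[symmetric] comp_def)
  qed
next
  case (SplitT c c')
  define g where "g = k div 2"
  have k: "k = 2 * g" using SplitT.prems by (simp add: g_def)
  show ?case
  proof (cases "t \<le> 0")
    case True
    then show ?thesis
      using SplitT.IH(1)[of h g "map (map (shift1 (- g))) Ps" s "t + g"] SplitT.prems k
      by (auto simp: g_def[symmetric] comp_def)
  next
    case False
    then show ?thesis
      using SplitT.IH(2)[of h g "map (map (shift1 g)) Ps" s "t - g"] SplitT.prems k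
      by (auto simp: g_def[symmetric] comp_def)
  qed
next
  case (Leaf l)
  then show ?case
    by (auto simp: list_all_iff eval2_combine[symmetric] intro!: exI[of _ l] eval2_nonneg)
qed


section \<open>The two-point inequality\<close>

text \<open>Write \<open>y = x * t\<close>, \<open>d = x - y\<close> and let \<open>W = 2 * profile ((x + y) / 2) - profile x - profile y\<close> be
  the concavity defect.  It is divisible by \<open>d\<^sup>2\<close> as a polynomial, and \<open>Q = W / d\<^sup>2\<close> stays of order one
  near the diagonal; this is what makes a certificate with finitely many pieces possible there.  The
  family consists of \<open>1\<close>, \<open>d\<close>, \<open>25 * profile x\<close>, \<open>50 * Q\<close>, \<open>50 * W\<close> and two polynomials
  \<open>1450 * F\<close> and \<open>50 * G\<close> with
  \<open>d - 17 / 29 * profile x - W = (1 - x) * F + t * G\<close>.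
  The left-hand side of this identity is the slack of the two-point inequality for the pair
  \<open>(12/29, 1)\<close>, and the test \<open>Step\<close> is for 1450 times this slack.  The slack vanishes at \<open>x = 1\<close>,
  \<open>t = 0\<close>, so that no test based on a dominating constant term can succeed near this point; there the
  test \<open>Corner\<close> is for the nonnegativity of \<open>F\<close> and \<open>G\<close> instead.  The test \<open>Angle k\<close> concerns the pairs
  on the unit circle: with \<open>\<kappa> = k / 20\<close> its polynomial is 20000 times
  \<open>2 * \<kappa> - 2 * \<kappa>\<^sup>2 * profile x - Q - \<kappa>\<^sup>2 * W\<close>, whose sign is interpreted by \<open>norm_ge_by_angle\<close>.\<close>

definition family :: "int list list list" where
  "family =
    [[[1]],
     [[], [1, -1]],
     [[], [51], [-99], [228], [-420], [368], [-128]],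
     [[99], [-342, -342], [735, 1050, 735], [-690, -1150, -1150, -690], [248, 448, 528, 448, 248]],
     [[], [], [99, -198, 99], [-342, 342, 342, -342], [735, -420, -630, -420, 735],
      [-690, 230, 460, 460, 230, -690], [248, -48, -120, -160, -120, -48, 248]],
     [[], [-284], [211], [2377], [-4658], [2840]],
     [[], [-50], [198, -99], [-342, -342, 342], [420, 630, 420, -735],
      [-230, -460, -460, -230, 690], [48, 120, 160, 120, 48, -248]]]"

definition defect :: "real \<Rightarrow> real \<Rightarrow> real" where
  "defect x y = 2 * profile ((x + y) / 2) - profile x - profile y"

definition curvature :: "real \<Rightarrow> real \<Rightarrow> real" where
  "curvature x t = eval2 (family ! 3) x t / 50"

lemma eval2_defect: "eval2 (family ! 4) x t = 50 * defect x (x * t)"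
  by (simp add: family_def defect_def profile_def field_simps eval_nat_numeral)

lemma defect_eq_curvature: "defect x (x * t) = (x - x * t) ^ 2 * curvature x t"
proof -
  have "eval2 (family ! 4) x t = (x - x * t) ^ 2 * eval2 (family ! 3) x t"
    by (simp add: family_def algebra_simps eval_nat_numeral)
  then show ?thesis unfolding eval2_defect curvature_def by simp
qed

lemma corner_identity:
  "1450 * (x - x * t) - 850 * profile x - 1450 * defect x (x * t) =
     (1 - x) * eval2 (family ! 5) x t + 29 * (t * eval2 (family ! 6) x t)"
proof -
  have "1450 * (x - x * t) - 850 * profile x - 29 * eval2 (family ! 4) x t =
     (1 - x) * eval2 (family ! 5) x t + 29 * (t * eval2 (family ! 6) x t)"
    by (simp add: family_def profile_def field_simps eval_nat_numeral)
  then show ?thesis unfolding eval2_defect by simp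
qed

lemma map_eval2_family:
  "map (\<lambda>P. eval2 P x t) family =
     [1, x - x * t, 25 * profile x, 50 * curvature x t, 50 * defect x (x * t),
      eval2 (family ! 5) x t, eval2 (family ! 6) x t]"
proof -
  have "family = [family ! 0, family ! 1, family ! 2, family ! 3, family ! 4, family ! 5, family ! 6]"
    by (simp add: family_def)
  then have "map (\<lambda>P. eval2 P x t) family = map (\<lambda>P. eval2 P x t)
      [family ! 0, family ! 1, family ! 2, family ! 3, family ! 4, family ! 5, family ! 6]"
    by (rule arg_cong)
  also have "\<dots> = [1, x - x * t, 25 * profile x, 50 * curvature x t, 50 * defect x (x * t),
      eval2 (family ! 5) x t, eval2 (family ! 6) x t]"
  proof -
    have "eval2 (family ! 0) x t = 1" by (simp add: family_def)
    moreover have "eval2 (family ! 1) x t = x - x * t" by (simp add: family_def algebra_simps)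
    moreover have "eval2 (family ! 2) x t = 25 * profile x"
      by (simp add: family_def profile_def algebra_simps eval_nat_numeral)
    ultimately show ?thesis by (simp add: eval2_defect curvature_def)
  qed
  finally show ?thesis .
qed

text \<open>The unit square is represented with 128 steps in the first and 64 steps in the second coordinate;
  six and five bisections then keep all midpoints integral.  The parameters of the \<open>Angle\<close> tests
  approximate \<open>20 * \<kappa>\<close> for the optimal \<open>\<kappa> = 1 / (profile x + sqrt ((profile x)\<^sup>2 + d\<^sup>2))\<close>, for which
  \<open>norm_ge_by_angle\<close> is sharp.\<close>

definition certificate :: cert where
  "certificate = SplitX (SplitX (SplitX (SplitX (SplitX (Leaf (Angle 294)) (Leaf (Angle 103))) (Leaf (Angle 54)))
   (Leaf (Angle 31))) (SplitX (SplitX (Leaf (Angle 22)) (Leaf (Angle 20))) (SplitX (SplitX (Leaf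
   (Angle 19)) (Leaf (Angle 20))) (SplitT (SplitT (Leaf (Angle 17)) (Leaf (Angle 18))) (Leaf (Angle
   20)))))) (SplitX (SplitX (SplitX (SplitT (SplitT (SplitT (SplitT (Leaf Step) (Leaf (Angle 16)))
   (Leaf (Angle 17))) (Leaf (Angle 18))) (SplitX (Leaf (Angle 20)) (Leaf (Angle 20)))) (SplitT
   (SplitT (SplitT (Leaf Step) (SplitX (Leaf (Angle 16)) (SplitT (Leaf Step) (Leaf (Angle 17)))))
   (Leaf (Angle 18))) (SplitT (Leaf (Angle 20)) (SplitX (Leaf (Angle 20)) (Leaf (Angle 20))))))
   (SplitX (SplitT (SplitT (SplitT (Leaf Step) (SplitX (SplitX (SplitT (Leaf Step) (Leaf (Angle 17)))
   (Leaf Step)) (Leaf Step))) (SplitX (Leaf (Angle 18)) (SplitT (SplitT (SplitT (Leaf Step) (Leaf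
   (Angle 18))) (Leaf (Angle 18))) (Leaf (Angle 18))))) (SplitT (Leaf (Angle 18)) (SplitX (Leaf
   (Angle 20)) (Leaf (Angle 21))))) (SplitT (SplitT (Leaf Step) (SplitT (SplitX (SplitT (Leaf Step)
   (Leaf (Angle 18))) (Leaf Step)) (Leaf (Angle 18)))) (SplitT (Leaf (Angle 19)) (SplitX (Leaf (Angle
   22)) (Leaf (Angle 23))))))) (SplitX (SplitT (SplitX (SplitT (Leaf Step) (SplitT (Leaf Step) (Leaf
   (Angle 19)))) (SplitX (Leaf Step) (Leaf Step))) (SplitT (SplitX (Leaf (Angle 20)) (Leaf (Angle
   23))) (SplitT (Leaf (Angle 24)) (SplitT (Leaf (Angle 25)) (SplitX (SplitX (Leaf (Angle 24)) (Leaf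
   (Angle 26))) (SplitX (Leaf (Angle 28)) (SplitX (Leaf (Angle 32)) (Leaf (Angle 34))))))))) (SplitT
   (SplitT (Leaf Corner) (Leaf Corner)) (SplitT (Leaf (Angle 34)) (SplitX (SplitX (SplitX (Leaf
   (Angle 37)) (Leaf (Angle 41))) (Leaf (Angle 47))) (SplitX (Leaf (Angle 66)) (Leaf (Angle
   107))))))))"

lemma certificate_check:
  "check certificate 64 32
     (map (map (shift1 32)) (map (shift2 64) (map (scale2 128 6 64 6) family)))"
  by code_simp

lemma certified_test:
  assumes "0 \<le> x" "x \<le> 1" "0 \<le> t" "t \<le> 1"
  shows "\<exists>l. \<forall>w\<in>set (weights l). 0 \<le> dot w (map (\<lambda>P. eval2 P x t) family)"
proof -
  define a :: real where "a = 128 ^ 6 * 64 ^ 6"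
  have "\<exists>l. \<forall>w\<in>set (weights l). 0 \<le> dot w (map (\<lambda>P. eval2 P (128 * x - 64) (64 * t - 32))
     (map (map (shift1 32)) (map (shift2 64) (map (scale2 128 6 64 6) family))))"
    by (rule check_sound[OF certificate_check]) (use assms in auto)
  moreover have "map (\<lambda>P. eval2 P (128 * x - 64) (64 * t - 32))
     (map (map (shift1 32)) (map (shift2 64) (map (scale2 128 6 64 6) family))) =
     map (\<lambda>P. a * eval2 P x t) family"
  proof -
    have "eval2 (map (shift1 32) (shift2 64 (scale2 128 6 64 6 P))) (128 * x - 64) (64 * t - 32) =
        a * eval2 P x t" if "P \<in> set family" for P
    proof -
      have "length P \<le> Suc 6 \<and> (\<forall>p\<in>set P. length p \<le> Suc 6)"
        using that by (auto simp: family_def)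
      then show ?thesis
        using eval2_scale2[of P 6 6 128 64 x t] by (simp add: a_def)
    qed
    then show ?thesis by simp
  qed
  ultimately have "\<exists>l. \<forall>w\<in>set (weights l). 0 \<le> a * dot w (map (\<lambda>P. eval2 P x t) family)"
    by (simp only: dot_scale)
  then show ?thesis by (simp add: a_def zero_le_mult_iff)
qed

text \<open>For \<open>\<kappa> > 0\<close> put \<open>\<tau> = \<kappa> * d\<close>.  The point \<open>((1 - \<tau>\<^sup>2) / (1 + \<tau>\<^sup>2), 2 * \<tau> / (1 + \<tau>\<^sup>2))\<close> lies on the unit
  circle, and the Cauchy-Schwarz inequality with it bounds the norm of \<open>(b, d)\<close> from below by
  \<open>b + d\<^sup>2 * (2 * \<kappa> - 2 * \<kappa>\<^sup>2 * b) / (1 + \<kappa>\<^sup>2 * d\<^sup>2)\<close>.  In this form the term \<open>b\<close> and the factor \<open>d\<^sup>2\<close> are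
  split off, and the remaining inequality for \<open>q\<close> is linear in \<open>b\<close>, \<open>q\<close> and \<open>d\<^sup>2 * q\<close>.\<close>

lemma norm_ge_by_angle:
  fixes b d q \<kappa> :: real
  assumes "q + \<kappa> ^ 2 * (d ^ 2 * q) \<le> 2 * \<kappa> - 2 * \<kappa> ^ 2 * b"
  shows "b + d ^ 2 * q \<le> sqrt (b ^ 2 + d ^ 2)"
proof -
  define r where "r = sqrt (b ^ 2 + d ^ 2)"
  define \<tau> where "\<tau> = \<kappa> * d"
  have r2: "r ^ 2 = b ^ 2 + d ^ 2" and r0: "0 \<le> r" by (simp_all add: r_def)
  have "((1 - \<tau> ^ 2) * b + 2 * \<tau> * d) ^ 2 + ((1 - \<tau> ^ 2) * d - 2 * \<tau> * b) ^ 2 =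
      ((1 + \<tau> ^ 2) * r) ^ 2"
    unfolding power_mult_distrib r2 by (simp add: algebra_simps eval_nat_numeral)
  then have "((1 - \<tau> ^ 2) * b + 2 * \<tau> * d) ^ 2 \<le> ((1 + \<tau> ^ 2) * r) ^ 2"
    using zero_le_power2[of "(1 - \<tau> ^ 2) * d - 2 * \<tau> * b"] by linarith
  then have cs: "(1 - \<tau> ^ 2) * b + 2 * \<tau> * d \<le> (1 + \<tau> ^ 2) * r"
    by (rule power2_le_imp_le) (use r0 in simp)
  have "d ^ 2 * (q + \<kappa> ^ 2 * (d ^ 2 * q)) \<le> d ^ 2 * (2 * \<kappa> - 2 * \<kappa> ^ 2 * b)"
    using assms by (intro mult_left_mono) auto
  then have "(1 + \<tau> ^ 2) * (b + d ^ 2 * q) \<le> (1 - \<tau> ^ 2) * b + 2 * \<tau> * d"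
    by (simp add: \<tau>_def algebra_simps power2_eq_square)
  with cs have "(1 + \<tau> ^ 2) * (b + d ^ 2 * q) \<le> (1 + \<tau> ^ 2) * r" by linarith
  moreover have "0 < 1 + \<tau> ^ 2" using zero_le_power2[of \<tau>] by linarith
  ultimately show ?thesis unfolding r_def by simp
qed

lemma two_point:
  assumes "0 \<le> y" "y \<le> x" "x \<le> 1"
  obtains \<alpha> \<beta> where "admissible \<alpha> \<beta>"
    "2 * profile ((x + y) / 2) \<le> \<alpha> * profile x + \<beta> * (x - y) + profile y"
proof (cases "x = y")
  case True
  have "admissible 1 0" by (rule admissible_circle) auto
  then show ?thesis using that[of 1 0] True by simp
next
  case False
  note pair = that
  define t where "t = y / x"
  have y: "y = x * t" and t: "0 \<le> t" "t \<le> 1" and d: "0 < x - y"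
    using assms False by (auto simp: t_def field_simps)
  have b: "0 \<le> profile x" using assms by (intro profile_nonneg) auto
  obtain l where l: "\<forall>w\<in>set (weights l). 0 \<le> dot w (map (\<lambda>P. eval2 P x t) family)"
    using certified_test[of x t] assms t by auto
  have step: thesis if "0 \<le> (x - y) - 17 / 29 * profile x - defect x y"
    using that pair[OF admissible_step] by (simp add: defect_def)
  show ?thesis
  proof (cases l)
    case (Angle k)
    define \<kappa> :: real where "\<kappa> = of_int k / 20"
    have "0 \<le> 2000 * of_int k - 4 * of_int k * of_int k * (25 * profile x) - 400 * (50 * curvature x t)
        - of_int k * of_int k * (50 * defect x y)"
      using l Angle by (simp add: map_eval2_family y)
    then have "curvature x t + \<kappa> ^ 2 * defect x y \<le> 2 * \<kappa> - 2 * \<kappa> ^ 2 * profile x"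
      by (simp add: \<kappa>_def power2_eq_square)
    then have "profile x + (x - y) ^ 2 * curvature x t \<le> sqrt ((profile x) ^ 2 + (x - y) ^ 2)"
      using norm_ge_by_angle[of "curvature x t" \<kappa> "x - y" "profile x"]
      by (simp add: y defect_eq_curvature)
    then have *: "profile x + defect x y \<le> sqrt ((profile x) ^ 2 + (x - y) ^ 2)"
      by (simp add: y defect_eq_curvature)
    define r where "r = sqrt ((profile x) ^ 2 + (x - y) ^ 2)"
    have r2: "r ^ 2 = (profile x) ^ 2 + (x - y) ^ 2" by (simp add: r_def)
    have r: "0 < r" using d by (simp add: r_def add_nonneg_pos)
    have "admissible (profile x / r) ((x - y) / r)"
      using b d r r2 by (intro admissible_circle) (auto simp: power_divide add_divide_distrib[symmetric])
    moreover have "profile x / r * profile x + (x - y) / r * (x - y) = r"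
      using r r2 by (simp add: power2_eq_square field_simps)
    ultimately show ?thesis
      using * pair[of "profile x / r" "(x - y) / r"] by (simp add: r_def[symmetric] defect_def)
  next
    case Step
    have "0 \<le> 1450 * (x - y) - 34 * (25 * profile x) - 29 * (50 * defect x y)"
      using l Step by (simp add: map_eval2_family y)
    then show ?thesis by (intro step) simp
  next
    case Corner
    have "0 \<le> eval2 (family ! 5) x t" "0 \<le> eval2 (family ! 6) x t"
      using l Corner by (simp_all add: map_eval2_family)
    then have "0 \<le> (1 - x) * eval2 (family ! 5) x t + 29 * (t * eval2 (family ! 6) x t)"
      using assms t by (intro add_nonneg_nonneg mult_nonneg_nonneg) auto
    then have "0 \<le> 1450 * (x - y) - 850 * profile x - 1450 * defect x y"
      unfolding corner_identity[symmetric] y .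
    then show ?thesis by (intro step) simp
  qed
qed


section \<open>Induction on the dimension\<close>

definition outdeg :: "nat \<Rightarrow> bool list set \<Rightarrow> bool list \<Rightarrow> nat" where
  "outdeg n S x = card {i. i < n \<and> x[i := \<not> x ! i] \<notin> S}"

definition section_at :: "bool \<Rightarrow> bool list set \<Rightarrow> bool list set" where
  "section_at a S = {x. a # x \<in> S}"

lemma outdeg_Cons:
  "outdeg (Suc n) S (a # x) = outdeg n (section_at a S) x + (if x \<in> section_at (\<not> a) S then 0 else 1)"
proof -
  let ?I = "{i. i < n \<and> x[i := \<not> x ! i] \<notin> section_at a S}"
  have "{i. i < Suc n \<and> (a # x)[i := \<not> (a # x) ! i] \<notin> S} =
      (if x \<in> section_at (\<not> a) S then {} else {0}) \<union> Suc ` ?I" (is "?L = ?R")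
  proof (rule set_eqI)
    show "i \<in> ?L \<longleftrightarrow> i \<in> ?R" for i
      by (cases i) (auto simp: section_at_def)
  qed
  moreover have "card ?R = card (if x \<in> section_at (\<not> a) S then {} else {0::nat}) + card (Suc ` ?I)"
    by (rule card_Un_disjoint) auto
  ultimately show ?thesis
    unfolding outdeg_def by (simp add: card_image)
qed

lemma finite_cube: "finite (cube n)"
  using finite_lists_length_eq[of "UNIV :: bool set" n] by (simp add: cube_def)

lemma card_cube: "card (cube n) = 2 ^ n"
  using card_lists_length_eq[of "UNIV :: bool set" n] by (simp add: cube_def)

lemma section_at_subset: "S \<subseteq> cube (Suc n) \<Longrightarrow> section_at a S \<subseteq> cube n"
  by (auto simp: section_at_def cube_def)

lemma sum_sections:
  fixes f :: "bool list \<Rightarrow> 'a :: comm_monoid_add"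
  assumes "S \<subseteq> cube (Suc n)"
  shows "sum f S = (\<Sum>x\<in>section_at a S. f (a # x)) + (\<Sum>x\<in>section_at (\<not> a) S. f ((\<not> a) # x))"
proof -
  have fin: "finite (section_at c S)" for c
    using section_at_subset[OF assms] finite_cube finite_subset by blast
  have "S = (#) a ` section_at a S \<union> (#) (\<not> a) ` section_at (\<not> a) S"
  proof (rule set_eqI)
    fix x
    show "x \<in> S \<longleftrightarrow> x \<in> (#) a ` section_at a S \<union> (#) (\<not> a) ` section_at (\<not> a) S"
    proof (cases x)
      case Nil
      then show ?thesis using assms by (auto simp: cube_def)
    next
      case (Cons c z)
      then show ?thesis by (cases "c = a") (auto simp: section_at_def)
    qed
  qed
  then have "sum f S = sum f ((#) a ` section_at a S \<union> (#) (\<not> a) ` section_at (\<not> a) S)"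
    by (rule arg_cong)
  also have "\<dots> = sum f ((#) a ` section_at a S) + sum f ((#) (\<not> a) ` section_at (\<not> a) S)"
    using fin by (intro sum.union_disjoint) auto
  also have "\<dots> = (\<Sum>x\<in>section_at a S. f (a # x)) + (\<Sum>x\<in>section_at (\<not> a) S. f ((\<not> a) # x))"
    by (simp add: sum.reindex)
  finally show ?thesis .
qed

text \<open>At the points of \<open>U\<close> outside \<open>V\<close> admissibility is applied; at the others only \<open>\<alpha> \<le> 1\<close> is.\<close>

lemma sum_sqrt_increment:
  fixes f :: "'a \<Rightarrow> nat"
  assumes "finite U" "finite V" "admissible \<alpha> \<beta>"
  shows "\<alpha> * (\<Sum>x\<in>U. sqrt (f x)) + \<beta> * (real (card U) - real (card V))
    \<le> (\<Sum>x\<in>U. sqrt (f x + (if x \<in> V then 0 else 1)))"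
proof -
  have "card U \<le> card (U - V) + card V"
    using assms card_mono[of "(U - V) \<union> V" U] card_Un_le[of "U - V" V] by auto
  then have "\<beta> * (real (card U) - real (card V)) \<le> \<beta> * real (card (U - V))"
    using assms by (intro mult_left_mono) (auto simp: admissible_def)
  also have "\<dots> = (\<Sum>x\<in>U. if x \<in> V then 0 else \<beta>)"
    using assms by (simp add: sum.If_cases Diff_eq Compl_eq)
  finally have "\<alpha> * (\<Sum>x\<in>U. sqrt (f x)) + \<beta> * (real (card U) - real (card V))
    \<le> (\<Sum>x\<in>U. \<alpha> * sqrt (f x) + (if x \<in> V then 0 else \<beta>))"
    by (simp add: sum.distrib sum_distrib_left)
  also have "\<dots> \<le> (\<Sum>x\<in>U. sqrt (f x + (if x \<in> V then 0 else 1)))"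
    using assms by (intro sum_mono) (auto simp: admissible_def mult_left_le_one_le add.commute)
  finally show ?thesis .
qed

lemma profile_le_boundary:
  "S \<subseteq> cube n \<Longrightarrow> 2 ^ n * profile (cube_measure n S) \<le> (\<Sum>x\<in>S. sqrt (outdeg n S x))"
proof (induction n arbitrary: S)
  case 0
  then have "S = {} \<or> S = {[]}" by (auto simp: cube_def)
  then show ?case by (auto simp: cube_measure_def sum_nonneg)
next
  case (Suc n)
  obtain a where a: "card (section_at (\<not> a) S) \<le> card (section_at a S)"
    using le_cases[of "card (section_at True S)" "card (section_at False S)"] by (metis (full_types))
  define U where "U = section_at a S"
  define V where "V = section_at (\<not> a) S"
  have sub: "U \<subseteq> cube n" "V \<subseteq> cube n"
    using section_at_subset[OF Suc.prems] by (auto simp: U_def V_def)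
  then have fin: "finite U" "finite V" using finite_cube finite_subset by blast+
  define x where "x = cube_measure n U"
  define y where "y = cube_measure n V"
  have card: "real (card U) = 2 ^ n * x" "real (card V) = 2 ^ n * y"
    by (simp_all add: x_def y_def cube_measure_def)
  have "card S = card U + card V"
    using sum_sections[OF Suc.prems, of "\<lambda>_. 1 :: nat" a] by (simp add: U_def V_def)
  then have mid: "cube_measure (Suc n) S = (x + y) / 2"
    by (simp add: cube_measure_def x_def y_def field_simps)
  have "card U \<le> 2 ^ n" using card_mono[OF finite_cube sub(1)] by (simp add: card_cube)
  then have "real (card U) \<le> 2 ^ n" by (simp flip: of_nat_le_iff)
  then have "x \<le> 1" "0 \<le> y" "y \<le> x"
    using a by (auto simp: x_def y_def cube_measure_def U_def V_def divide_right_mono)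
  then obtain \<alpha> \<beta> where adm: "admissible \<alpha> \<beta>"
    and ineq: "2 * profile ((x + y) / 2) \<le> \<alpha> * profile x + \<beta> * (x - y) + profile y"
    using two_point by blast
  have "2 ^ Suc n * profile (cube_measure (Suc n) S) = 2 ^ n * (2 * profile ((x + y) / 2))"
    by (simp add: mid)
  also have "\<dots> \<le> 2 ^ n * (\<alpha> * profile x + \<beta> * (x - y) + profile y)"
    using ineq by (intro mult_left_mono) auto
  also have "\<dots> = \<alpha> * (2 ^ n * profile x) + \<beta> * (real (card U) - real (card V)) + 2 ^ n * profile y"
    by (simp add: card algebra_simps)
  also have "\<dots> \<le> \<alpha> * (\<Sum>x\<in>U. sqrt (outdeg n U x)) + \<beta> * (real (card U) - real (card V)) +
      (\<Sum>x\<in>V. sqrt (outdeg n V x))"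
    using Suc.IH[OF sub(1)] Suc.IH[OF sub(2)] adm
    by (intro add_mono mult_left_mono) (auto simp: x_def y_def admissible_def)
  also have "\<dots> \<le> (\<Sum>x\<in>U. sqrt (outdeg n U x + (if x \<in> V then 0 else 1))) +
      (\<Sum>x\<in>V. sqrt (outdeg n V x + (if x \<in> U then 0 else 1)))"
    by (intro add_mono sum_sqrt_increment fin adm sum_mono) auto
  also have "\<dots> = (\<Sum>x\<in>S. sqrt (outdeg (Suc n) S x))"
    unfolding sum_sections[OF Suc.prems, of _ a] by (simp add: outdeg_Cons U_def V_def)
  finally show ?case .
qed


section \<open>From vertex sums to edges\<close>

lemma flip_cube_edge:
  assumes "y \<in> cube n" "i < n"
  shows "(y[i := \<not> y ! i], y) \<in> cube_edges n"
  using assms by (auto simp: cube_edges_def cube_def nth_list_update intro!: ex1I[of _ i] split: if_splits)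

lemma sum_outdeg_le_edges:
  assumes "cube_partition n A B W"
  shows "(\<Sum>y\<in>B. outdeg n (B \<union> W) y) \<le> card {(x, y) \<in> cube_edges n. x \<in> A \<and> y \<in> B}"
proof -
  let ?E = "{(x, y) \<in> cube_edges n. x \<in> A \<and> y \<in> B}"
  let ?I = "\<lambda>y. {i. i < n \<and> y[i := \<not> y ! i] \<notin> B \<union> W}"
  let ?e = "\<lambda>(y, i). (y[i := \<not> y ! i], y)"
  have cube: "A \<union> B \<union> W = cube n" using assms by (simp add: cube_partition_def)
  then have finB: "finite B" using finite_cube[of n] by (metis finite_Un)
  have finE: "finite ?E"
    by (rule finite_subset[of _ "cube n \<times> cube n"]) (auto simp: cube_edges_def finite_cube)
  have "inj_on ?e (SIGMA y:B. ?I y)"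
  proof (rule inj_onI)
    fix p q
    assume pq: "p \<in> (SIGMA y:B. ?I y)" "q \<in> (SIGMA y:B. ?I y)" "?e p = ?e q"
    then obtain y i j where y: "p = (y, i)" "q = (y, j)" by (cases p; cases q) auto
    with pq have "y \<in> B" "i < n" "y[i := \<not> y ! i] = y[j := \<not> y ! j]" by auto
    moreover from \<open>y \<in> B\<close> have "length y = n" using cube by (auto simp: cube_def)
    ultimately have "i = j" by (metis nth_list_update_eq nth_list_update_neq)
    then show "p = q" using y by simp
  qed
  moreover have "?e ` (SIGMA y:B. ?I y) \<subseteq> ?E"
  proof -
    have "(y[i := \<not> y ! i], y) \<in> cube_edges n \<and> y[i := \<not> y ! i] \<in> A"
      if yi: "y \<in> B" "i < n" "y[i := \<not> y ! i] \<notin> B \<union> W" for y i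
    proof -
      have y: "y \<in> cube n" using yi cube by auto
      then have "y[i := \<not> y ! i] \<in> cube n" by (simp add: cube_def)
      then show ?thesis using yi cube flip_cube_edge[OF y yi(2)] by blast
    qed
    then show ?thesis by auto
  qed
  ultimately have "card (SIGMA y:B. ?I y) \<le> card ?E" using finE by (rule card_inj_on_le)
  then show ?thesis using finB by (simp add: outdeg_def)
qed

theorem corollary1p9:
  fixes n :: nat and A B W :: "bool list set"
  assumes "n \<ge> 1"
    and "cube_partition n A B W"
    and "cube_measure n A = 1 / 2"
  shows "edge_measure n A B + real n powr 0.50057 * cube_measure n W \<ge> 1 / 2"
proof -
  define C where "C = B \<union> W"
  have part: "A \<inter> C = {}" "B \<inter> W = {}" "A \<union> C = cube n"
    using assms(2) by (auto simp: cube_partition_def C_def)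
  then have fin: "finite A" "finite C" "finite B" "finite W"
    using finite_cube[of n] by (auto simp: C_def simp flip: part(3))
  have "card A + card C = 2 ^ n"
    using card_Un_disjoint[OF fin(1,2) part(1)] by (simp add: part(3) card_cube)
  then have "real (card A) + real (card C) = 2 ^ n"
    by (metis of_nat_add of_nat_numeral of_nat_power)
  then have "cube_measure n A + cube_measure n C = 1"
    by (simp add: cube_measure_def add_divide_distrib[symmetric])
  then have "cube_measure n C = 1 / 2" using assms(3) by linarith
  then have "profile (cube_measure n C) = 1 / 2" by (simp only: profile_simps)
  moreover have "C \<subseteq> cube n" using part by blast
  ultimately have "2 ^ n * (1 / 2) \<le> (\<Sum>x\<in>C. sqrt (outdeg n C x))"
    using profile_le_boundary[of C n] by (simp only:)
  also have "\<dots> = (\<Sum>x\<in>B. sqrt (outdeg n C x)) + (\<Sum>x\<in>W. sqrt (outdeg n C x))"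
    unfolding C_def using fin part(2) by (intro sum.union_disjoint) auto
  also have "(\<Sum>x\<in>B. sqrt (outdeg n C x)) \<le> (\<Sum>x\<in>B. real (outdeg n C x))"
  proof (rule sum_mono)
    have "real k \<le> (real k) ^ 2" for k :: nat
      by (cases k) (auto simp: power2_eq_square)
    then show "sqrt (outdeg n C x) \<le> real (outdeg n C x)" for x
      by (intro real_le_lsqrt) auto
  qed
  also have "\<dots> \<le> real (card {(x, y) \<in> cube_edges n. x \<in> A \<and> y \<in> B})"
    using sum_outdeg_le_edges[OF assms(2)] unfolding C_def by (simp flip: of_nat_sum)
  also have "(\<Sum>x\<in>W. sqrt (outdeg n C x)) \<le> (\<Sum>x\<in>W. real n powr 0.50057)"
  proof (rule sum_mono)
    fix x
    have "outdeg n C x \<le> card {..<n}"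
      unfolding outdeg_def by (rule card_mono) auto
    then have "sqrt (outdeg n C x) \<le> real n powr (1 / 2)"
      using assms(1) by (simp add: powr_half_sqrt)
    also have "\<dots> \<le> real n powr 0.50057"
      using assms(1) by (intro powr_mono) auto
    finally show "sqrt (outdeg n C x) \<le> real n powr 0.50057" .
  qed
  finally have "2 ^ n * (1 / 2) \<le> real (card {(x, y) \<in> cube_edges n. x \<in> A \<and> y \<in> B}) +
      real (card W) * real n powr 0.50057"
    by simp
  then show ?thesis
    by (simp add: edge_measure_def cube_measure_def field_simps)
qed

end
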